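(* Let $p>1$ be given, and let $\Gamma$ be the set of all $x\in\Sigma$ for which there exists $c>0$ (depending on $x$) such that for all $n\in\mathbb N$, $$\frac1n\left(\sum_{k=1}^n\frac1{f^{k-1}(x)^p}\right)\le c.$$ Then no normal number belongs to $\Gamma$, $\Gamma$ has (Lebesgue) measure zero, and the set of simply normal numbers that are in $\Gamma$ is uncountable.
   Context: $\mathbb N=\{1,2,3,\dots\}$. The map $f:[0,1)\to[0,1)$ is $f(x)=2x$ if $0\le x<1/2$ and $f(x)=2x-1$ if $1/2\le x<1$; $f^k$ is the $k$-fold composition, $f^0(x)=x$. $\Sigma$ is the set of $x\in[0,1)$ that are not binary rationals (a binary rational is $0$ or a number $k/2^n$ with $k,n\in\mathbb N$, $1\le k<2^n$). Each $x\in\Sigma$ has a unique binary expansion $x=\sum_{k\ge1}d_k/2^k$, $d_k\in\{0,1\}$. $x\in\Sigma$ is normal (to base 2) if for every $r\in\mathbb N$ and every block $e_1e_2\dots e_r$ of digits in $\{0,1\}$, $\lim_{n\to\infty}\frac1n|\{k:1\le k\le n,\ d_k=e_1,d_{k+1}=e_2,\dots,d_{k+r-1}=e_r\}|=2^{-r}$. $x\in\Sigma$ is simply normal (to base 2) if $\lim_{n\to\infty}\frac1n|\{k:1\le k\le n,\ d_k=0\}|=\frac12$ and $\lim_{n\to\infty}\frac1n|\{k:1\le k\le n,\ d_k=1\}|=\frac12$. *)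

theory Defs
  imports "HOL-Analysis.Analysis"
begin

text \<open>
  The doubling map of \<open>[0,1)\<close>. The formula is used on all reals, but it is only
  iterated from points of \<open>[0,1)\<close>, an interval that it maps into itself.
\<close>
definition doubling :: "real \<Rightarrow> real" where
  "doubling x = (if x < 1/2 then 2 * x else 2 * x - 1)"

lemma doubling_in_unit: "x \<in> {0..<1} \<Longrightarrow> doubling x \<in> {0..<1}"
  by (auto simp: doubling_def)

definition binary_rational :: "real \<Rightarrow> bool" where
  "binary_rational x \<longleftrightarrow>
     x = 0 \<or> (\<exists>k n::nat. 1 \<le> n \<and> 1 \<le> k \<and> k < 2 ^ n \<and> x = real k / 2 ^ n)"

definition Sigma_set :: "real set" where
  "Sigma_set = {x \<in> {0..<1}. \<not> binary_rational x}"

text \<open>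
  Digits are indexed from 1; the value at the unused index 0 is set to 0 so that
  the sequence is unique as a function on \<^typ>\<open>nat\<close>.
\<close>
definition is_binary_expansion :: "(nat \<Rightarrow> nat) \<Rightarrow> real \<Rightarrow> bool" where
  "is_binary_expansion d x \<longleftrightarrow>
     d 0 = 0 \<and> (\<forall>k\<ge>1. d k \<in> {0, 1}) \<and> (\<lambda>k. real (d (Suc k)) / 2 ^ Suc k) sums x"

definition binary_digit :: "real \<Rightarrow> nat \<Rightarrow> nat" where
  "binary_digit x = (THE d. is_binary_expansion d x)"

definition normal_number :: "real \<Rightarrow> bool" where
  "normal_number x \<longleftrightarrow> x \<in> Sigma_set \<and>
     (\<forall>r::nat. \<forall>e::nat \<Rightarrow> nat. 1 \<le> r \<and> (\<forall>i\<in>{1..r}. e i \<in> {0, 1}) \<longrightarrow>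
        (\<lambda>n. real (card {k \<in> {1..n}. \<forall>i\<in>{1..r}. binary_digit x (k + i - 1) = e i}) / real n)
          \<longlonglongrightarrow> 1 / 2 ^ r)"

definition simply_normal_number :: "real \<Rightarrow> bool" where
  "simply_normal_number x \<longleftrightarrow> x \<in> Sigma_set \<and>
     (\<lambda>n. real (card {k \<in> {1..n}. binary_digit x k = 0}) / real n) \<longlonglongrightarrow> 1 / 2 \<and>
     (\<lambda>n. real (card {k \<in> {1..n}. binary_digit x k = 1}) / real n) \<longlonglongrightarrow> 1 / 2"

text \<open>
  For \<open>x \<in> Sigma_set\<close> the iterates of \<open>doubling\<close> at \<open>x\<close> are positive, so
  \<open>powr\<close> is the usual real power and the quotients are genuine.
\<close>
definition Gamma_set :: "real \<Rightarrow> real set" where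
  "Gamma_set p = {x \<in> Sigma_set. \<exists>c>0. \<forall>n\<ge>1.
     1 / real n * (\<Sum>k=1..n. 1 / ((doubling ^^ (k - 1)) x) powr p) \<le> c}"

text \<open>The definite description in \<open>binary_digit\<close> is well defined on \<open>Sigma_set\<close>.\<close>

lemma floor_binary_expansion:
  assumes x: "x \<in> Sigma_set" and d: "is_binary_expansion d x"
  shows "\<lfloor>2 ^ n * x\<rfloor> = (\<Sum>k<n. int (d (Suc k)) * 2 ^ (n - Suc k))"
proof -
  define S where "S = (\<Sum>k<n. int (d (Suc k)) * 2 ^ (n - Suc k))"
  define g where "g = (\<lambda>k. real (d (Suc k)) / 2 ^ Suc k)"
  have gx: "g sums x" using d by (simp add: is_binary_expansion_def g_def)
  have d01: "d (Suc k) \<in> {0, 1}" for k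
    using d unfolding is_binary_expansion_def by (metis One_nat_def Suc_le_mono le0)
  have S: "2 ^ n * (\<Sum>k<n. g k) = real_of_int S"
  proof -
    have "2 ^ n * g k = real (d (Suc k)) * 2 ^ (n - Suc k)" if "k < n" for k
      using power_add[of "2::real" "Suc k" "n - Suc k"] that
      by (simp add: g_def field_simps)
    then show ?thesis by (simp add: S_def sum_distrib_left)
  qed
  have tail: "(\<lambda>k. g (k + n)) sums (x - (\<Sum>k<n. g k))"
    using gx by (rule sums_split_initial_segment)
  have geo: "(\<lambda>k. (1/2) ^ Suc n * (1/2) ^ k :: real) sums ((1/2) ^ n)"
    using sums_mult[OF geometric_sums[of "1/2::real"], of "(1/2) ^ Suc n"] by simp
  have lo: "0 \<le> x - (\<Sum>k<n. g k)"
    by (rule sums_le[OF _ sums_zero tail]) (simp add: g_def)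
  have hi: "x - (\<Sum>k<n. g k) \<le> (1/2) ^ n"
  proof (rule sums_le[OF _ tail geo])
    fix k show "g (k + n) \<le> (1/2) ^ Suc n * (1/2) ^ k"
      using d01[of "k + n"] by (auto simp: g_def power_add power_divide mult_ac)
  qed
  have l: "real_of_int S \<le> 2 ^ n * x"
    using mult_left_mono[OF lo, of "2 ^ n"] S by (simp only: right_diff_distrib) simp
  have "2 ^ n * (x - (\<Sum>k<n. g k)) \<le> 2 ^ n * (1/2) ^ n"
    by (rule mult_left_mono[OF hi]) simp
  then have h: "2 ^ n * x \<le> real_of_int S + 1"
    using S by (simp add: algebra_simps power_divide)
  have ne: "2 ^ n * x \<noteq> real_of_int S + 1"
  proof
    assume eq: "2 ^ n * x = real_of_int S + 1"
    have "S \<ge> 0" unfolding S_def by (intro sum_nonneg) auto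
    define k where "k = nat (S + 1)"
    have k: "k \<ge> 1" "real k = 2 ^ n * x" using eq \<open>S \<ge> 0\<close> by (auto simp: k_def)
    have x01: "0 \<le> x" "x < 1" using x by (auto simp: Sigma_set_def)
    have "2 ^ n * x < 2 ^ n * 1" by (rule mult_strict_left_mono) (use x01 in auto)
    then have "real k < real (2 ^ n)" using k by simp
    then have kn: "k < 2 ^ n" by (simp only: of_nat_less_iff)
    then have "n \<ge> 1" using k by (cases n) auto
    moreover have "x = real k / 2 ^ n" using k by simp
    ultimately have "binary_rational x" using k(1) kn unfolding binary_rational_def by blast
    then show False using x by (simp add: Sigma_set_def)
  qed
  show ?thesis unfolding S_def[symmetric] using l h ne by (intro floor_unique) auto
qed

lemma binary_expansion_exists:
  assumes x: "0 \<le> x" "x < (1::real)"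
  shows "\<exists>d. is_binary_expansion d x"
proof -
  define F where "F = (\<lambda>n::nat. \<lfloor>2 ^ n * x\<rfloor>)"
  define d where "d = (\<lambda>k. case k of 0 \<Rightarrow> 0 | Suc n \<Rightarrow> nat (F (Suc n) - 2 * F n))"
  have step: "F (Suc n) - 2 * F n \<in> {0, 1}" for n
  proof -
    have "2 * F n \<le> F (Suc n)"
      unfolding F_def by (subst le_floor_iff) (use of_int_floor_le[of "2^n*x"] in \<open>simp; linarith\<close>)
    moreover have "F (Suc n) < 2 * F n + 2"
      unfolding F_def by (subst floor_less_iff) (use floor_correct[of "2^n*x"] in \<open>simp; linarith\<close>)
    ultimately show ?thesis by auto
  qed
  have dS: "real (d (Suc n)) = F (Suc n) - 2 * F n" for n
    using step[of n] by (auto simp: d_def)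
  have "F 0 = 0" using x by (simp add: F_def floor_eq_iff)
  have ps: "(\<Sum>k<n. real (d (Suc k)) / 2 ^ Suc k) = F n / 2 ^ n" for n
    by (induction n) (use \<open>F 0 = 0\<close> in \<open>simp_all add: dS field_simps\<close>)
  have "(\<lambda>n. F n / 2 ^ n) \<longlonglongrightarrow> x"
  proof (rule tendsto_sandwich)
    show "\<forall>\<^sub>F n in sequentially. x - (1/2) ^ n \<le> F n / 2 ^ n"
    proof (intro always_eventually allI)
      fix n show "x - (1/2) ^ n \<le> F n / 2 ^ n"
      proof -
        have "x - (1/2) ^ n = (2 ^ n * x - 1) / 2 ^ n"
          by (simp add: diff_divide_distrib power_divide)
        also have "\<dots> \<le> F n / 2 ^ n"
          using floor_correct[of "2 ^ n * x"] by (intro divide_right_mono) (auto simp: F_def)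
        finally show ?thesis .
      qed
    qed
    show "\<forall>\<^sub>F n in sequentially. F n / 2 ^ n \<le> x"
      by (intro always_eventually allI)
        (use of_int_floor_le in \<open>simp add: F_def field_simps\<close>)
    have "(\<lambda>n. x - (1/2) ^ n) \<longlonglongrightarrow> x - 0"
      by (intro tendsto_intros LIMSEQ_realpow_zero) auto
    then show "(\<lambda>n. x - (1/2) ^ n) \<longlonglongrightarrow> x" by simp
  qed auto
  then have "(\<lambda>k. real (d (Suc k)) / 2 ^ Suc k) sums x"
    unfolding sums_def ps .
  moreover have "d k \<in> {0, 1}" if k1: "k \<ge> 1" for k
  proof -
    obtain n where "k = Suc n" using k1 by (cases k) auto
    then show ?thesis using step[of n] by (auto simp: d_def)
  qed
  ultimately show ?thesis
    unfolding is_binary_expansion_def by (intro exI[of _ d]) (auto simp: d_def)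
qed

lemma binary_expansion_ex1:
  assumes x: "x \<in> Sigma_set"
  shows "\<exists>!d. is_binary_expansion d x"
proof (rule ex_ex1I)
  show "\<exists>d. is_binary_expansion d x"
    using x binary_expansion_exists by (auto simp: Sigma_set_def)
next
  fix d d' assume d: "is_binary_expansion d x" "is_binary_expansion d' x"
  have rec: "int (b (Suc n)) = \<lfloor>2 ^ Suc n * x\<rfloor> - 2 * \<lfloor>2 ^ n * x\<rfloor>"
    if b: "is_binary_expansion b x" for b n
  proof -
    have "(\<Sum>k<n. int (b (Suc k)) * 2 ^ (Suc n - Suc k)) =
          2 * (\<Sum>k<n. int (b (Suc k)) * 2 ^ (n - Suc k))"
      unfolding sum_distrib_left
    proof (rule sum.cong)
      fix k assume "k \<in> {..<n}"
      then have "Suc n - Suc k = Suc (n - Suc k)" by auto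
      then show "int (b (Suc k)) * 2 ^ (Suc n - Suc k) = 2 * (int (b (Suc k)) * 2 ^ (n - Suc k))"
        by simp
    qed simp
    then show ?thesis
      unfolding floor_binary_expansion[OF x b] by simp
  qed
  show "d = d'"
  proof
    fix k show "d k = d' k"
    proof (cases k)
      case 0 then show ?thesis using d by (simp add: is_binary_expansion_def)
    next
      case (Suc n) then show ?thesis using rec[OF d(1), of n] rec[OF d(2), of n] by simp
    qed
  qed
qed

lemma is_binary_expansion_binary_digit:
  "x \<in> Sigma_set \<Longrightarrow> is_binary_expansion (binary_digit x) x"
  unfolding binary_digit_def by (rule theI'[OF binary_expansion_ex1])

end

(*
A block of r zeros at position k forces f^(k-1)(x) <= 2^(-r), so it contributes at least 2^(rp)
to the sum. For normal x such blocks have frequency 2^(-r), and the averages exceed about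
2^(r(p-1)) for every r. For the measure, put n = L^2 2^L. If the averages are at most N and
N n < 2^(Lp), which holds for large L, then none of the first L 2^L disjoint blocks of length L
is zero, and this has probability (1 - 2^(-L))^(L 2^L) <= exp(-L). Finally, a concatenation of
pairs 01 and 10 is simply normal, and since its runs have length at most 2 the orbit stays
above 1/8; there are uncountably many such concatenations.
*)

theory Submission
  imports Defs "HOL-Real_Asymp.Real_Asymp"
begin

section \<open>Orbits of the doubling map in terms of fractional parts and digits\<close>

text \<open>On [0,1) one doubling step is \<open>frac (2 * y)\<close>, and replacing
  \<open>2 ^ n * x\<close> by its fractional part before doubling changes the result only by an
  integer.\<close>

lemma funpow_doubling_eq_frac:
  assumes "x \<in> {0..<1}"
  shows "(doubling ^^ n) x = frac (2 ^ n * x)"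
proof (induction n)
  case 0
  show ?case using assms by (simp add: frac_eq)
next
  case (Suc n)
  define y where "y = frac (2 ^ n * x)"
  have "2 ^ Suc n * x = 2 * y + of_int (2 * \<lfloor>2 ^ n * x\<rfloor>)"
    by (simp add: y_def frac_def)
  then have "frac (2 ^ Suc n * x) = frac (2 * y)"
    by (metis Ints_of_int frac_add_of_int_right)
  moreover have "frac (2 * y) = doubling y"
  proof -
    have "0 \<le> y" "y < 1" by (auto simp: y_def frac_lt_1)
    then show ?thesis
      
      by (auto simp: doubling_def frac_eq frac_unique_iff)
  qed
  ultimately show ?case using Suc by (simp add: y_def)
qed

text \<open>Clearing the denominator turns binary rationals into integrality of some
  \<open>2 ^ n * x\<close>. Together with the closed form of the iterates this says that the orbit
  never reaches 0.\<close>

lemma Sigma_set_iff: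
  "x \<in> Sigma_set \<longleftrightarrow> x \<in> {0..<1} \<and> (\<forall>n. 2 ^ n * x \<notin> \<int>)"
proof safe
  fix n assume x: "x \<in> Sigma_set" and "2 ^ n * x \<in> \<int>"
  then obtain z where z: "2 ^ n * x = of_int z" by (auto elim: Ints_cases)
  have "0 \<le> x" "x < 1" "x \<noteq> 0"
    using x by (auto simp: Sigma_set_def binary_rational_def)
  then have "0 < x" by simp
  then have "0 < real_of_int z" by (simp flip: z)
  define k where "k = nat z"
  have k: "k \<ge> 1" "real k = 2 ^ n * x" using \<open>0 < real_of_int z\<close> by (auto simp: k_def z)
  have "real k < real (2 ^ n)" using k \<open>x < 1\<close> by simp
  then have "k < 2 ^ n" by (simp only: of_nat_less_iff)
  \<comment> \<open>For \<open>n = 0\<close> the bounds would read 1 \<le> k < 1.\<close>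
  moreover from this k have "n \<ge> 1" by (cases n) auto
  moreover have "x = real k / 2 ^ n" using k by simp
  ultimately have "binary_rational x" using k(1) unfolding binary_rational_def by blast
  then show False using x by (simp add: Sigma_set_def)
next
  assume x: "x \<in> {0..<1}" and nint: "\<forall>n. 2 ^ n * x \<notin> \<int>"
  have "\<not> binary_rational x"
  proof
    assume "binary_rational x"
    then consider "x = 0" | k n :: nat where "x = real k / 2 ^ n"
      by (auto simp: binary_rational_def)
    then show False
    proof cases
      case 1
      then show ?thesis using nint by simp
    next
      case (2 k n)
      then have "2 ^ n * x = of_nat k" by simp
      then show ?thesis using nint by (metis Ints_of_nat)
    qed
  qed
  then show "x \<in> Sigma_set" using x by (simp add: Sigma_set_def)
qed (auto simp: Sigma_set_def)

lemma funpow_doubling_pos: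
  assumes "x \<in> Sigma_set"
  shows "(doubling ^^ n) x > 0"
  using assms by (simp add: Sigma_set_iff funpow_doubling_eq_frac)

lemma funpow_doubling_less_1:
  assumes "x \<in> Sigma_set"
  shows "(doubling ^^ n) x < 1"
  using assms by (simp add: Sigma_set_iff funpow_doubling_eq_frac frac_lt_1)

text \<open>Multiplying by \<open>2 ^ n\<close> moves the binary point: the first \<open>n\<close>
  digits form the integer that is subtracted, and the remaining digits form the series. It is stated
  for an arbitrary expansion because \<open>bounded_runs\<close> uses it to derive membership in
  \<open>Sigma_set\<close>.\<close>

lemma sums_binary_shift:
  assumes "is_binary_expansion d x"
  shows "(\<lambda>k. real (d (Suc (k + n))) / 2 ^ Suc k) sums
    (2 ^ n * x - of_int (\<Sum>k<n. int (d (Suc k)) * 2 ^ (n - Suc k)))"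
proof -
  have "(\<lambda>k. real (d (Suc k)) / 2 ^ Suc k) sums x"
    using assms by (simp add: is_binary_expansion_def)
  then have "(\<lambda>k. 2 ^ n * (real (d (Suc (k + n))) / 2 ^ Suc (k + n))) sums
      (2 ^ n * (x - (\<Sum>k<n. real (d (Suc k)) / 2 ^ Suc k)))"
    by (intro sums_mult sums_split_initial_segment)
  moreover have "2 ^ n * (real (d (Suc (k + n))) / 2 ^ Suc (k + n)) =
      real (d (Suc (k + n))) / 2 ^ Suc k" for k
    by (simp add: power_add)
  moreover have "2 ^ n * (real (d (Suc k)) / 2 ^ Suc k) = real (d (Suc k)) * 2 ^ (n - Suc k)"
    if "k < n" for k
    using power_add[of "2::real" "Suc k" "n - Suc k"] that by (simp add: field_simps)
  ultimately show ?thesis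
    by (simp add: right_diff_distrib sum_distrib_left)
qed

text \<open>The integer split off in \<open>sums_binary_shift\<close> is the floor of
  \<open>2 ^ n * x\<close>, so the tail is its fractional part: the doubling map acts as the shift
  on digits.\<close>

lemma sums_funpow_doubling:
  assumes "x \<in> Sigma_set"
  shows "(\<lambda>k. real (binary_digit x (Suc (k + n))) / 2 ^ Suc k) sums (doubling ^^ n) x"
proof -
  have d: "is_binary_expansion (binary_digit x) x"
    using assms by (rule is_binary_expansion_binary_digit)
  have "(doubling ^^ n) x = 2 ^ n * x - of_int \<lfloor>2 ^ n * x\<rfloor>"
    using assms by (simp add: funpow_doubling_eq_frac Sigma_set_iff frac_def)
  then show ?thesis
    using sums_binary_shift[OF d, of n] floor_binary_expansion[OF assms d, of n] by simp
qed

text \<open>Deleting \<open>r\<close> leading zeros from the expansion of the n-th iterate gives the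
  iterate at \<open>n + r\<close>, scaled by \<open>1 / 2 ^ r\<close>; every iterate is below
  1.\<close>

lemma funpow_doubling_le_of_zero_block:
  assumes x: "x \<in> Sigma_set" and zero: "\<And>i. i < r \<Longrightarrow> binary_digit x (Suc (n + i)) = 0"
  shows "(doubling ^^ n) x \<le> 1 / 2 ^ r"
proof -
  have "(\<lambda>k. real (binary_digit x (Suc (k + r + n))) / 2 ^ Suc (k + r)) sums
      ((doubling ^^ n) x - (\<Sum>k<r. real (binary_digit x (Suc (k + n))) / 2 ^ Suc k))"
    using sums_split_initial_segment[OF sums_funpow_doubling[OF x, of n], of r] by simp
  moreover have "(\<Sum>k<r. real (binary_digit x (Suc (k + n))) / 2 ^ Suc k) = 0"
    using zero by (simp add: add.commute)
  ultimately have "(\<lambda>k. real (binary_digit x (Suc (k + r + n))) / 2 ^ Suc (k + r))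
      sums (doubling ^^ n) x"
    by simp
  moreover have "(\<lambda>k. 1 / 2 ^ r * (real (binary_digit x (Suc (k + (n + r)))) / 2 ^ Suc k))
      sums (1 / 2 ^ r * (doubling ^^ (n + r)) x)"
    by (intro sums_mult sums_funpow_doubling x)
  ultimately have "(doubling ^^ n) x = 1 / 2 ^ r * (doubling ^^ (n + r)) x"
    by (simp add: sums_iff power_add ac_simps)
  also have "\<dots> \<le> 1 / 2 ^ r * 1"
    using funpow_doubling_less_1[OF x, of "n + r"] by (intro mult_left_mono) auto
  finally show ?thesis by simp
qed

section \<open>Normal numbers\<close>

lemma normal_number_not_in_Gamma_set:
  assumes p: "p > 1" and x: "normal_number x"
  shows "x \<notin> Gamma_set p"
proof
  assume "x \<in> Gamma_set p"
  then obtain c where c: "c > 0"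
    "\<And>n. n \<ge> 1 \<Longrightarrow> 1 / real n * (\<Sum>k=1..n. 1 / ((doubling ^^ (k - 1)) x) powr p) \<le> c"
    by (auto simp: Gamma_set_def)
  have xS: "x \<in> Sigma_set" using x by (simp add: normal_number_def)
  \<comment> \<open>For fixed \<open>r\<close>, the limit in \<open>n\<close> bounds frequency times
    term size, 2^(-r) * 2^(rp), by \<open>c\<close>; only afterwards does \<open>r\<close>
    grow.\<close>
  have bound: "(2 powr (p - 1)) ^ r \<le> c" if r: "r \<ge> 1" for r :: nat
  proof -
    define K where "K = (\<lambda>n. {k \<in> {1..n}. \<forall>i\<in>{1..r}. binary_digit x (k + i - 1) = 0})"
    have "(\<lambda>n. real (card (K n)) / real n) \<longlonglongrightarrow> 1 / 2 ^ r"
      using x r unfolding normal_number_def K_def by (elim conjE allE[of _ r] allE[of _ "\<lambda>_. 0"]) auto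
    then have "(\<lambda>n. real (card (K n)) / real n * (2 ^ r) powr p) \<longlonglongrightarrow> 1 / 2 ^ r * (2 ^ r) powr p"
      by (rule tendsto_mult_right)
    moreover have "real (card (K n)) / real n * (2 ^ r) powr p \<le> c" if n: "n \<ge> 1" for n
    proof -
      have "real (card (K n)) * (2 ^ r) powr p = (\<Sum>k\<in>K n. (2 ^ r) powr p)" by simp
      also have "\<dots> \<le> (\<Sum>k\<in>K n. 1 / ((doubling ^^ (k - 1)) x) powr p)"
      proof (rule sum_mono)
        fix k assume k: "k \<in> K n"
        have "(doubling ^^ (k - 1)) x \<le> 1 / 2 ^ r"
        proof (rule funpow_doubling_le_of_zero_block[OF xS])
          \<comment> \<open>Blocks are indexed from 1 in the definition of normality and from 0
            here, and position \<open>k\<close> corresponds to the iterate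
            \<open>k - 1\<close>.\<close>
          fix i assume "i < r"
          then have "Suc i \<in> {1..r}" by auto
          then have "binary_digit x (k + Suc i - 1) = 0" using k unfolding K_def by blast
          moreover have "Suc (k - 1 + i) = k + Suc i - 1" using k by (auto simp: K_def)
          ultimately show "binary_digit x (Suc (k - 1 + i)) = 0" by simp
        qed
        then have "((doubling ^^ (k - 1)) x) powr p \<le> (1 / 2 ^ r) powr p"
          using p funpow_doubling_pos[OF xS, of "k - 1"] by (intro powr_mono2) auto
        then have "1 / (1 / 2 ^ r) powr p \<le> 1 / ((doubling ^^ (k - 1)) x) powr p"
          using funpow_doubling_pos[OF xS, of "k - 1"] by (intro divide_left_mono) auto
        then show "(2 ^ r) powr p \<le> 1 / ((doubling ^^ (k - 1)) x) powr p"
          by (simp add: powr_divide)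
      qed
      also have "\<dots> \<le> (\<Sum>k=1..n. 1 / ((doubling ^^ (k - 1)) x) powr p)"
        by (rule sum_mono2) (auto simp: K_def)
      finally have "1 / real n * (real (card (K n)) * (2 ^ r) powr p) \<le>
          1 / real n * (\<Sum>k=1..n. 1 / ((doubling ^^ (k - 1)) x) powr p)"
        by (intro mult_left_mono) auto
      then show ?thesis using c(2)[OF n] by simp
    qed
    ultimately have "1 / 2 ^ r * (2 ^ r) powr p \<le> c"
      by (intro LIMSEQ_le_const2) auto
    moreover have "1 / 2 ^ r * (2 ^ r) powr p = (2 powr (p - 1)) ^ r"
      by (simp add: powr_diff power_divide powr_powr mult.commute flip: powr_realpow)
    ultimately show ?thesis by simp
  qed
  have "1 < 2 powr (p - 1)" using p by simp
  then obtain r where r: "c < (2 powr (p - 1)) ^ r" using real_arch_pow by blast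
  \<comment> \<open>The Archimedean exponent may be 0, while \<open>bound\<close> requires a
    positive one; hence the passage to \<open>Suc r\<close>.\<close>
  also have "\<dots> \<le> (2 powr (p - 1)) ^ Suc r"
    using \<open>1 < 2 powr (p - 1)\<close> by (intro power_increasing) auto
  finally show False using bound[of "Suc r"] by simp
qed

section \<open>Measure zero\<close>

lemma lmeasurable_affine:
  fixes S :: "'a::euclidean_space set"
  assumes "S \<in> lmeasurable"
  shows "(\<lambda>x. m *\<^sub>R x + c) ` S \<in> lmeasurable"
proof -
  have "(\<lambda>x. m *\<^sub>R x + c) ` S \<in> sets lebesgue"
    using assms by (intro differentiable_image_in_sets_lebesgue) auto
  moreover have "emeasure lebesgue ((\<lambda>x. m *\<^sub>R x + c) ` S) < \<infinity>"
    unfolding emeasure_lebesgue_affine emeasure_eq_measure2[OF assms]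
    by (simp add: ennreal_mult_less_top power_less_top_ennreal)
  ultimately show ?thesis by (rule fmeasurableI)
qed

text \<open>The condition at \<open>j\<close> says that digits \<open>j * L + 1\<close> to
  \<open>(j + 1) * L\<close> are not all zero. Fractional parts express this without choosing an
  expansion, so binary rationals are covered too.\<close>

definition avoids_zero_blocks :: "nat \<Rightarrow> nat \<Rightarrow> real set" where
  "avoids_zero_blocks L m = {x \<in> {0..<1}. \<forall>j<m. 1 / 2 ^ L \<le> frac (2 ^ (j * L) * x)}"

text \<open>
  Splitting off the first block, which is one of \<open>2 ^ L - 1\<close> nonzero blocks,
  gains a factor \<open>1 - 1 / 2 ^ L\<close>.
\<close>
lemma avoids_zero_blocks_Suc_subset:
  "avoids_zero_blocks L (Suc m) \<subseteq>
    (\<Union>i\<in>{1..<2 ^ L}. (\<lambda>y. (1 / 2 ^ L) *\<^sub>R y + real i / 2 ^ L) ` avoids_zero_blocks L m)"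
proof
  fix x assume x: "x \<in> avoids_zero_blocks L (Suc m)"
  then have x01: "0 \<le> x" "x < 1" by (auto simp: avoids_zero_blocks_def)
  have block: "1 / 2 ^ L \<le> frac (2 ^ (j * L) * x)" if "j < Suc m" for j
    using x that by (simp add: avoids_zero_blocks_def)
  \<comment> \<open>\<open>i\<close> is the first block of \<open>L\<close> digits read as an
    integer, and \<open>y\<close> is the number formed by the digits after it.\<close>
  define i where "i = nat \<lfloor>2 ^ L * x\<rfloor>"
  define y where "y = frac (2 ^ L * x)"
  have "0 \<le> y" by (simp add: y_def)
  have i: "int i = \<lfloor>2 ^ L * x\<rfloor>" using x01 by (simp add: i_def)
  then have "real i = of_int \<lfloor>2 ^ L * x\<rfloor>" by (metis of_int_of_nat_eq)
  then have xy: "2 ^ L * x = y + real i" by (simp add: y_def frac_def)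
  have "1 / 2 ^ L \<le> x" using block[of 0] x01 by (simp add: frac_eq)
  then have "1 \<le> 2 ^ L * x" by (simp add: field_simps)
  then have "1 \<le> i" using i by linarith
  moreover have "i < 2 ^ L"
  proof -
    have "real i \<le> 2 ^ L * x" using xy \<open>0 \<le> y\<close> by linarith
    also have "2 ^ L * x < 2 ^ L * 1" using x01 by (intro mult_strict_left_mono) auto
    finally have "real i < real (2 ^ L)" by simp
    then show ?thesis by (simp only: of_nat_less_iff)
  qed
  moreover have "y \<in> avoids_zero_blocks L m"
    unfolding avoids_zero_blocks_def
  proof (intro CollectI conjI allI impI)
    fix j assume "j < m"
    \<comment> \<open>Block \<open>j\<close> of \<open>y\<close> is block \<open>Suc j\<close> of
      \<open>x\<close>, since the two scaled numbers differ by an integer.\<close>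
    have "2 ^ (Suc j * L) * x = 2 ^ (j * L) * (2 ^ L * x)"
      by (simp add: power_add mult_ac)
    also have "\<dots> = 2 ^ (j * L) * y + of_int (2 ^ (j * L) * int i)"
      unfolding xy by (simp add: distrib_left)
    finally have "frac (2 ^ (Suc j * L) * x) = frac (2 ^ (j * L) * y)"
      by (metis frac_add_of_int_right)
    then show "1 / 2 ^ L \<le> frac (2 ^ (j * L) * y)"
      using block[of "Suc j"] \<open>j < m\<close> by simp
  qed (simp add: y_def frac_lt_1)
  moreover have "x = (1 / 2 ^ L) *\<^sub>R y + real i / 2 ^ L"
    using xy by (simp add: field_simps)
  ultimately show "x \<in> (\<Union>i\<in>{1..<2 ^ L}.
      (\<lambda>y. (1 / 2 ^ L) *\<^sub>R y + real i / 2 ^ L) ` avoids_zero_blocks L m)"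
    by auto
qed

text \<open>A measurable cover is enough for negligibility, so the induction carries a cover
  \<open>B\<close>. The next cover consists of \<open>2 ^ L - 1\<close> copies of \<open>B\<close>,
  each shrunk by \<open>1 / 2 ^ L\<close>, and finite subadditivity gives the factor.\<close>

lemma avoids_zero_blocks_outer_measure:
  "\<exists>B\<in>lmeasurable. avoids_zero_blocks L m \<subseteq> B \<and> measure lebesgue B \<le> (1 - 1 / 2 ^ L) ^ m"
proof (induction m)
  case 0
  have "avoids_zero_blocks L 0 \<subseteq> {0..1}" by (auto simp: avoids_zero_blocks_def)
  then show ?case by (intro bexI[of _ "{0..1}"]) auto
next
  case (Suc m)
  then obtain B where B: "B \<in> lmeasurable" "avoids_zero_blocks L m \<subseteq> B"
    "measure lebesgue B \<le> (1 - 1 / 2 ^ L) ^ m"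
    by blast
  define T where "T = (\<lambda>i::nat. (\<lambda>y::real. (1 / 2 ^ L) *\<^sub>R y + real i / 2 ^ L) ` B)"
  have T: "T i \<in> lmeasurable" for i
    unfolding T_def using B(1) by (rule lmeasurable_affine)
  have "measure lebesgue (T i) = 1 / 2 ^ L * measure lebesgue B" for i
    unfolding T_def by (subst measure_lebesgue_affine) simp
  then have "measure lebesgue (\<Union>i\<in>{1..<2 ^ L}. T i) \<le>
      (\<Sum>i\<in>{1..<2 ^ L::nat}. 1 / 2 ^ L * measure lebesgue B)"
    using measure_UNION_le[of "{1..<2 ^ L}" T lebesgue] T by (simp add: fmeasurableD)
  also have "\<dots> = (1 - 1 / 2 ^ L) * measure lebesgue B"
    by (simp add: of_nat_diff field_simps)
  also have "\<dots> \<le> (1 - 1 / 2 ^ L) * (1 - 1 / 2 ^ L) ^ m"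
    using B(3) by (intro mult_left_mono) auto
  finally have "measure lebesgue (\<Union>i\<in>{1..<2 ^ L}. T i) \<le> (1 - 1 / 2 ^ L) ^ Suc m"
    by simp
  moreover have "avoids_zero_blocks L (Suc m) \<subseteq> (\<Union>i\<in>{1..<2 ^ L}. T i)"
    using avoids_zero_blocks_Suc_subset[of L m] B(2) by (fastforce simp: T_def)
  moreover have "(\<Union>i\<in>{1..<2 ^ L}. T i) \<in> lmeasurable"
    using T by (intro fmeasurable.finite_UN) auto
  ultimately show ?case by blast
qed

lemma Gamma_set_null:
  assumes p: "p > 1"
  shows "Gamma_set p \<in> null_sets lebesgue"
proof -
  \<comment> \<open>Natural bounds \<open>N\<close> in place of real \<open>c\<close> make the cover
    of \<open>Gamma_set p\<close> countable.\<close>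
  define G where "G = (\<lambda>N::nat. {x \<in> Sigma_set. \<forall>n\<ge>1.
     1 / real n * (\<Sum>k=1..n. 1 / ((doubling ^^ (k - 1)) x) powr p) \<le> real N})"
  have "Gamma_set p \<subseteq> (\<Union>N. G N)"
  proof
    fix x assume "x \<in> Gamma_set p"
    then obtain c where x: "x \<in> Sigma_set" and c:
      "\<And>n. n \<ge> 1 \<Longrightarrow> 1 / real n * (\<Sum>k=1..n. 1 / ((doubling ^^ (k - 1)) x) powr p) \<le> c"
      by (auto simp: Gamma_set_def)
    obtain N where "c \<le> real N" using real_arch_simple by blast
    then have "x \<in> G N" using x c unfolding G_def by (blast intro: order_trans)
    then show "x \<in> (\<Union>N. G N)" by blast
  qed
  moreover have "negligible (G N)" for N
    unfolding negligible_outer_le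
  proof (intro allI impI)
    fix e :: real assume "e > 0"
    \<comment> \<open>The left side is \<open>N * n\<close> for the later choice
      \<open>n = m * L\<close>; the right side wins because p > 1.\<close>
    have "eventually (\<lambda>L::nat. real N * (real L * real L * 2 ^ L) < (2 ^ L) powr p) sequentially"
      using p by real_asymp
    moreover have "eventually (\<lambda>L::nat. exp (- real L) < e) sequentially"
      using \<open>e > 0\<close> by real_asymp
    ultimately have "eventually (\<lambda>L::nat. real N * (real L * real L * 2 ^ L) < (2 ^ L) powr p \<and>
        exp (- real L) < e \<and> L \<ge> 1) sequentially"
      using eventually_ge_at_top[of 1] by eventually_elim auto
    then obtain L :: nat where L: "real N * (real L * real L * 2 ^ L) < (2 ^ L) powr p"
      "exp (- real L) < e" "L \<ge> 1"
      by (auto simp: eventually_sequentially)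
    define m where "m = L * 2 ^ L"
    have "G N \<subseteq> avoids_zero_blocks L m"
    proof
      fix x assume x: "x \<in> G N"
      then have xS: "x \<in> Sigma_set" by (simp add: G_def)
      \<comment> \<open>A single iterate below \<open>1 / 2 ^ L\<close> contributes at least
        \<open>(2 ^ L) powr p\<close>, which already exceeds the whole sum allowed by
        \<open>N\<close>.\<close>
      have "1 / 2 ^ L \<le> (doubling ^^ (j * L)) x" if "j < m" for j
      proof (rule ccontr)
        define t where "t = (doubling ^^ (j * L)) x"
        assume "\<not> 1 / 2 ^ L \<le> (doubling ^^ (j * L)) x"
        then have t: "0 < t" "t \<le> 1 / 2 ^ L"
          using funpow_doubling_pos[OF xS] by (auto simp: t_def)
        \<comment> \<open>The total length of the \<open>m\<close> blocks. The start of block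
          \<open>j\<close> is summand \<open>Suc (j * L)\<close>, which lies in range because L
          \<ge> 1.\<close>
        define n where "n = m * L"
        have "Suc j * L \<le> n" unfolding n_def using that by (intro mult_right_mono) auto
        then have jn: "Suc (j * L) \<in> {1..n}" using L(3) by simp
        then have "n \<ge> 1" by auto
        have "t powr p \<le> (1 / 2 ^ L) powr p" using t p by (intro powr_mono2) auto
        then have "1 / (1 / 2 ^ L) powr p \<le> 1 / t powr p"
          using t by (intro divide_left_mono) auto
        then have "(2 ^ L) powr p \<le> 1 / t powr p" by (simp add: powr_divide)
        also have "\<dots> \<le> (\<Sum>k=1..n. 1 / ((doubling ^^ (k - 1)) x) powr p)"
          using member_le_sum[OF jn, of "\<lambda>k. 1 / ((doubling ^^ (k - 1)) x) powr p"]
          by (simp add: t_def)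
        also have "\<dots> \<le> real N * real n"
        proof -
          have "1 / real n * (\<Sum>k=1..n. 1 / ((doubling ^^ (k - 1)) x) powr p) \<le> real N"
            using x \<open>n \<ge> 1\<close> unfolding G_def by blast
          then show ?thesis using \<open>n \<ge> 1\<close> by (simp add: field_simps)
        qed
        finally show False using L(1) by (simp add: n_def m_def mult_ac)
      qed
      then show "x \<in> avoids_zero_blocks L m"
        using xS by (simp add: avoids_zero_blocks_def Sigma_set_iff funpow_doubling_eq_frac)
    qed
    moreover obtain B where "B \<in> lmeasurable" "avoids_zero_blocks L m \<subseteq> B"
      "measure lebesgue B \<le> (1 - 1 / 2 ^ L) ^ m"
      using avoids_zero_blocks_outer_measure by blast
    moreover have "(1 - 1 / 2 ^ L) ^ m \<le> exp (- real L)"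
    proof -
      \<comment> \<open>This is 1 + t \<le> exp t at t = -1/2^L; the exponent
        \<open>m = L * 2 ^ L\<close> then gives exactly exp(-L).\<close>
      have "1 - 1 / 2 ^ L \<le> exp (- (1 / 2 ^ L :: real))"
        using exp_ge_add_one_self[of "- (1 / 2 ^ L :: real)"] by simp
      then have "(1 - 1 / 2 ^ L) ^ m \<le> exp (- (1 / 2 ^ L :: real)) ^ m"
        by (intro power_mono) auto
      also have "\<dots> = exp (- real L)"
        by (simp add: m_def flip: exp_of_nat_mult)
      finally show ?thesis .
    qed
    ultimately show "\<exists>T. G N \<subseteq> T \<and> T \<in> lmeasurable \<and> measure lebesgue T \<le> e"
      using L(2) by (intro exI[of _ B]) auto
  qed
  then have "negligible (\<Union>N. G N)"
    by (intro negligible_countable_Union) auto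
  ultimately show ?thesis
    using negligible_subset negligible_iff_null_sets by blast
qed

section \<open>Expansions with bounded runs\<close>

lemma is_binary_expansion_suminf:
  assumes "d 0 = 0" and "\<And>k. d k \<in> {0, 1}"
  shows "is_binary_expansion d (\<Sum>k. real (d (Suc k)) / 2 ^ Suc k)"
proof -
  have "summable (\<lambda>k. real (d (Suc k)) / 2 ^ Suc k)"
  proof (rule summable_comparison_test)
    have "real (d (Suc k)) / 2 ^ Suc k \<le> (1 / 2) ^ k" for k
      using assms(2)[of "Suc k"] by (auto simp: power_divide field_simps)
    then show "\<exists>N. \<forall>k\<ge>N. norm (real (d (Suc k)) / 2 ^ Suc k) \<le> (1 / 2) ^ k" by auto
    show "summable (\<lambda>k. (1 / 2 :: real) ^ k)" by (simp add: summable_geometric)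
  qed
  then show ?thesis
    using assms by (simp add: is_binary_expansion_def summable_sums del: power_Suc)
qed

text \<open>The digit 1 at index \<open>i\<close> alone contributes \<open>1 / 2 ^ Suc i\<close>,
  with \<open>Suc i \<le> r\<close>, and all other terms are nonnegative.\<close>

lemma binary_sums_ge:
  fixes b :: "nat \<Rightarrow> nat"
  assumes sums: "(\<lambda>k. real (b k) / 2 ^ Suc k) sums s" and i: "i < r" "b i = 1"
  shows "1 / 2 ^ r \<le> s"
proof -
  have "(1 / 2 ^ r :: real) \<le> 1 / 2 ^ Suc i"
    using i by (intro divide_left_mono power_increasing) auto
  also have "\<dots> = (\<Sum>k\<in>{i}. real (b k) / 2 ^ Suc k)" using i by simp
  also have "\<dots> \<le> (\<Sum>k. real (b k) / 2 ^ Suc k)"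
    using sums by (intro sum_le_suminf) (auto simp: sums_iff)
  finally show ?thesis using sums by (simp add: sums_iff)
qed

text \<open>Complementing the digits turns \<open>s\<close> into \<open>1 - s\<close> and the digit
  0 into a digit 1, which reduces the claim to \<open>binary_sums_ge\<close>.\<close>

lemma binary_sums_le:
  fixes b :: "nat \<Rightarrow> nat"
  assumes sums: "(\<lambda>k. real (b k) / 2 ^ Suc k) sums s"
    and b: "\<And>k. b k \<in> {0, 1}" and i: "i < r" "b i = 0"
  shows "s \<le> 1 - 1 / 2 ^ r"
proof -
  have "(\<lambda>k. (1 / 2 :: real) * (1 / 2) ^ k) sums (1 / 2 * (1 / (1 - 1 / 2)))"
    by (intro sums_mult geometric_sums) auto
  then have "(\<lambda>k. 1 / 2 ^ Suc k - real (b k) / 2 ^ Suc k) sums (1 - s)"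
    using sums by (intro sums_diff) (auto simp: power_divide)
  moreover have "1 / 2 ^ Suc k - real (b k) / 2 ^ Suc k = real (1 - b k) / 2 ^ Suc k" for k
    using b[of k] by auto
  ultimately have "(\<lambda>k. real (1 - b k) / 2 ^ Suc k) sums (1 - s)" by simp
  from binary_sums_ge[OF this i(1)] i(2) show ?thesis by simp
qed

text \<open>
  Bounded runs of zeros keep the orbit away from \<open>0\<close>; bounded runs of both digits
  exclude binary rationals.
\<close>
lemma bounded_runs:
  assumes d: "is_binary_expansion d x" and runs: "\<And>n e. e \<in> {0, 1} \<Longrightarrow> \<exists>i<r. d (Suc (i + n)) = e"
  shows "x \<in> Sigma_set" and "1 / 2 ^ r \<le> (doubling ^^ n) x"
proof -
  have d01: "d (Suc k) \<in> {0, 1}" for k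
    using d unfolding is_binary_expansion_def by (metis One_nat_def Suc_le_mono le0)
  \<comment> \<open>\<open>z\<close> is the integer formed by the first \<open>n\<close> digits. The
    tail has both a 0 and a 1 among its first \<open>r\<close> digits, so it stays away from both 1
    and 0; this is what identifies \<open>z\<close> as the floor below.\<close>
  have ex: "\<exists>z::int. 1 / 2 ^ r \<le> 2 ^ n * x - z \<and> 2 ^ n * x - z \<le> 1 - 1 / 2 ^ r" for n
  proof -
    note sums = sums_binary_shift[OF d, of n]
    obtain i j where "i < r" "d (Suc (i + n)) = 0" "j < r" "d (Suc (j + n)) = 1"
      using runs[of 0 n] runs[of 1 n] by auto
    then show ?thesis
      using binary_sums_ge[OF sums, of j r] binary_sums_le[OF sums d01, of i r] by blast
  qed
  have bounds: "1 / 2 ^ r \<le> frac (2 ^ n * x)" for n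
  proof -
    obtain z :: int where z: "1 / 2 ^ r \<le> 2 ^ n * x - z" "2 ^ n * x - z \<le> 1 - 1 / 2 ^ r"
      using ex by blast
    have "(0::real) < 1 / 2 ^ r" by simp
    then have "0 \<le> 2 ^ n * x - z" "2 ^ n * x - z < 1" using z by linarith+
    then have "frac (2 ^ n * x) = 2 ^ n * x - z" by (simp add: frac_unique_iff)
    then show ?thesis using z by simp
  qed
  have "2 ^ n * x \<notin> \<int>" for n
  proof -
    have "(0::real) < 1 / 2 ^ r" by simp
    also note bounds[of n]
    finally show ?thesis by simp
  qed
  moreover have "x \<in> {0..<1}"
  proof -
    \<comment> \<open>At \<open>n = 0\<close> the subtracted integer is an empty sum, so the bounds
      apply to \<open>x\<close> itself and not just modulo 1.\<close>
    note sums = sums_binary_shift[OF d, of 0]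
    obtain i j where "i < r" "d (Suc i) = 0" "j < r" "d (Suc j) = 1"
      using runs[of 0 0] runs[of 1 0] by auto
    then have "1 / 2 ^ r \<le> x" "x \<le> 1 - 1 / 2 ^ r"
      using binary_sums_ge[OF sums, of j r] binary_sums_le[OF sums d01, of i r] by auto
    moreover have "(0::real) < 1 / 2 ^ r" by simp
    ultimately show ?thesis unfolding atLeastLessThan_iff by linarith
  qed
  ultimately show "x \<in> Sigma_set" by (simp add: Sigma_set_iff)
  then show "1 / 2 ^ r \<le> (doubling ^^ n) x"
    using bounds by (simp add: Sigma_set_iff funpow_doubling_eq_frac)
qed

lemma Gamma_set_of_bounded_below:
  assumes p: "p > 0" and x: "x \<in> Sigma_set" and a: "a > 0" "\<And>n. a \<le> (doubling ^^ n) x"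
  shows "x \<in> Gamma_set p"
proof -
  have "1 / real n * (\<Sum>k=1..n. 1 / ((doubling ^^ (k - 1)) x) powr p) \<le> 1 / a powr p"
    if "n \<ge> 1" for n
  proof -
    have "(\<Sum>k=1..n. 1 / ((doubling ^^ (k - 1)) x) powr p) \<le> (\<Sum>k=1..n. 1 / a powr p)"
    proof (rule sum_mono)
      fix k
      have "a powr p \<le> ((doubling ^^ (k - 1)) x) powr p" using p a by (intro powr_mono2) auto
      then show "1 / ((doubling ^^ (k - 1)) x) powr p \<le> 1 / a powr p"
        using a(1) by (intro frac_le) auto
    qed
    then show ?thesis using that by (simp add: field_simps)
  qed
  moreover have "1 / a powr p > 0" using a by simp
  ultimately show ?thesis using x unfolding Gamma_set_def by blast
qed

section \<open>Uncountably many simply normal numbers from digit pairs\<close>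

text \<open>The digits come in pairs \<open>10\<close> or \<open>01\<close>, the \<open>j\<close>-th pair telling whether \<open>j \<in> A\<close>.\<close>
fun paired_digit :: "nat set \<Rightarrow> nat \<Rightarrow> nat" where
  "paired_digit A 0 = 0"
| "paired_digit A (Suc n) = of_bool (n div 2 \<in> A \<longleftrightarrow> even n)"

definition paired_number :: "nat set \<Rightarrow> real" where
  "paired_number A = (\<Sum>k. real (paired_digit A (Suc k)) / 2 ^ Suc k)"

lemma paired_digit_cases: "paired_digit A k \<in> {0, 1}"
  by (cases k) auto

text \<open>Pair \<open>j\<close> occupies positions \<open>2 * j + 1\<close> and
  \<open>2 * j + 2\<close> and contains both digits. Any three consecutive positions contain a whole
  pair, after skipping one position when \<open>n\<close> is odd.\<close>

lemma paired_digit_runs: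
  assumes "e \<in> {0, 1}"
  shows "\<exists>i<3. paired_digit A (Suc (i + n)) = e"
proof -
  have pair: "\<exists>i<2. paired_digit A (Suc (i + 2 * j)) = e" for j
  proof -
    have "paired_digit A (Suc (0 + 2 * j)) = of_bool (j \<in> A)"
      "paired_digit A (Suc (1 + 2 * j)) = of_bool (j \<notin> A)" by simp_all
    moreover have "e = of_bool (j \<in> A) \<or> e = of_bool (j \<notin> A)" using assms by auto
    ultimately show ?thesis by (metis one_less_numeral_iff semiring_norm(76) zero_less_numeral)
  qed
  show ?thesis
  proof (cases "even n")
    case True
    then obtain j where "n = 2 * j" by blast
    with pair[of j] show ?thesis by (metis less_trans lessI numeral_2_eq_2 numeral_3_eq_3)
  next
    case False
    then obtain j where j: "Suc n = 2 * j" by (metis even_Suc evenE)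
    obtain i where "i < 2" "paired_digit A (Suc (i + Suc n)) = e" using pair[of j] j by metis
    then show ?thesis by (intro exI[of _ "Suc i"]) auto
  qed
qed

lemma is_binary_expansion_paired_number:
  "is_binary_expansion (paired_digit A) (paired_number A)"
  unfolding paired_number_def
  using paired_digit_cases by (intro is_binary_expansion_suminf) auto

lemmas paired_number_in_Sigma_set =
  bounded_runs(1)[OF is_binary_expansion_paired_number paired_digit_runs]

lemma binary_digit_paired_number: "binary_digit (paired_number A) = paired_digit A"
  using binary_expansion_ex1[OF paired_number_in_Sigma_set]
    is_binary_expansion_binary_digit[OF paired_number_in_Sigma_set]
    is_binary_expansion_paired_number by blast

lemma inj_paired_number: "inj paired_number"
proof (rule injI)
  fix A B assume "paired_number A = paired_number B"
  then have "paired_digit A = paired_digit B" by (metis binary_digit_paired_number)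
  \<comment> \<open>The first digit of pair \<open>j\<close> is 1 exactly when \<open>j\<close>
    belongs to the set.\<close>
  then have "paired_digit A (Suc (2 * j)) = paired_digit B (Suc (2 * j))" for j by simp
  then show "A = B" by (auto simp: of_bool_eq_iff)
qed

text \<open>Each pair contains \<open>e\<close> exactly once, so the count is exact at even
  \<open>n\<close> and differs from n/2 by at most 1/2 at odd \<open>n\<close>.\<close>

lemma paired_digit_frequency:
  assumes e: "e \<in> {0, 1}"
  shows "(\<lambda>n. real (card {k \<in> {1..n}. paired_digit A k = e}) / real n) \<longlonglongrightarrow> 1 / 2"
proof -
  define Z where "Z = (\<lambda>n. card {k \<in> {1..n}. paired_digit A k = e})"
  have step: "Z (Suc n) = Z n + of_bool (paired_digit A (Suc n) = e)" for n
  proof -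
    have "{k \<in> {1..Suc n}. paired_digit A k = e} =
      (if paired_digit A (Suc n) = e then {Suc n} else {}) \<union> {k \<in> {1..n}. paired_digit A k = e}"
      by (auto simp: le_Suc_eq)
    then show ?thesis by (simp add: Z_def)
  qed
  have even: "Z (2 * m) = m" for m
  proof (induction m)
    case 0
    show ?case by (simp add: Z_def)
  next
    case (Suc m)
    have "Z (2 * Suc m) = Z (Suc (Suc (2 * m)))" by simp
    also have "\<dots> = Suc m" using e Suc.IH unfolding step by auto
    finally show ?case .
  qed
  have near: "\<bar>2 * real (Z n) - real n\<bar> \<le> 1" for n
  proof (cases "even n")
    case True
    then show ?thesis using even by auto
  next
    case False
    then obtain m where n: "n = Suc (2 * m)" by (auto elim: oddE)
    show ?thesis unfolding n step even by auto
  qed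
  have "(\<lambda>n. Z n / real n - 1 / 2) \<longlonglongrightarrow> 0"
  proof (rule Lim_null_comparison)
    show "\<forall>\<^sub>F n in sequentially. norm (Z n / real n - 1 / 2) \<le> 1 / real n"
      \<comment> \<open>At \<open>n = 0\<close> both quotients are 0 by convention and the bound
        fails.\<close>
      using eventually_gt_at_top[of 0]
    proof eventually_elim
      case (elim n)
      then have "Z n / real n - 1 / 2 = (2 * real (Z n) - real n) / (2 * real n)"
        by (simp add: field_simps)
      also have "norm \<dots> \<le> 1 / (2 * real n)"
        using near[of n] by (simp add: divide_right_mono)
      also have "\<dots> \<le> 1 / real n" using elim by (simp add: field_simps)
      finally show ?case .
    qed
    show "(\<lambda>n. 1 / real n) \<longlonglongrightarrow> 0" by (rule lim_1_over_n)
  qed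
  then show ?thesis by (simp add: LIM_zero_iff Z_def)
qed

lemma uncountable_UNIV_nat_set: "uncountable (UNIV :: nat set set)"
  using Cantors_theorem[of "UNIV :: nat set"] unfolding uncountable_def Pow_UNIV
  by (intro conjI UNIV_not_empty)

theorem theorem4p5:
  fixes p :: real
  assumes "p > 1"
  shows "(\<forall>x. normal_number x \<longrightarrow> x \<notin> Gamma_set p) \<and>
    Gamma_set p \<in> null_sets lebesgue \<and>
    uncountable {x. simply_normal_number x \<and> x \<in> Gamma_set p}"
proof (intro conjI allI impI)
  show "x \<notin> Gamma_set p" if "normal_number x" for x
    using assms that by (rule normal_number_not_in_Gamma_set)
  show "Gamma_set p \<in> null_sets lebesgue"
    using assms by (rule Gamma_set_null)
  \<comment> \<open>The lower bound \<open>1 / 2 ^ 3\<close> for the orbit comes from the window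
    length 3 in \<open>paired_digit_runs\<close>.\<close>
  have "paired_number A \<in> Gamma_set p" for A
    using assms bounded_runs(2)[OF is_binary_expansion_paired_number paired_digit_runs]
    by (intro Gamma_set_of_bounded_below[of p _ "1 / 2 ^ 3"] paired_number_in_Sigma_set) auto
  moreover have "simply_normal_number (paired_number A)" for A
    unfolding simply_normal_number_def binary_digit_paired_number
    by (intro conjI paired_number_in_Sigma_set paired_digit_frequency) auto
  ultimately have "range paired_number \<subseteq> {x. simply_normal_number x \<and> x \<in> Gamma_set p}"
    by auto
  moreover have "uncountable (range paired_number)"
    using uncountable_UNIV_nat_set countable_image_inj_eq[OF inj_paired_number] by simp
  ultimately show "uncountable {x. simply_normal_number x \<and> x \<in> Gamma_set p}"
    using countable_subset by blast
qed

end
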